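(* Let $n\geq 2$ be an integer. For any integers $a,b\geq 1$ we have $$|UD_n((a,b))|=n^{a+b}-n^{\gcd(a,b)}.$$
   Context: Let $X$ be a finite alphabet with $n$ letters. $UD_n((a,b))$ denotes the set of all pairs $(v_1,v_2)$ of words over $X$ with $|v_1|=a$, $|v_2|=b$ that are uniquely decodable, i.e. such that $v_{i_1}v_{i_2}\cdots v_{i_t}=v_{j_1}v_{j_2}\cdots v_{j_{t'}}$ with $t,t'\geq 1$ and all indices in $\{1,2\}$ implies $t=t'$ and $i_s=j_s$ for every $1\leq s\leq t$. *)

theory Defs
  imports Complex_Main
begin

(* The factors v_1, v_2 of the pair are indexed by 1 and 2, as in the informal definition;
   an index sequence i_1 ... i_t with t >= 1 is a nonempty list over {1, 2}. *)

definition pair_word :: "'a list \<times> 'a list \<Rightarrow> nat \<Rightarrow> 'a list" where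
  "pair_word v i = (if i = 1 then fst v else snd v)"

definition uniquely_decodable :: "'a list \<times> 'a list \<Rightarrow> bool" where
  "uniquely_decodable v \<longleftrightarrow>
     (\<forall>is js. is \<noteq> [] \<longrightarrow> js \<noteq> [] \<longrightarrow> set is \<subseteq> {1, 2} \<longrightarrow> set js \<subseteq> {1, 2} \<longrightarrow>
        concat (map (pair_word v) is) = concat (map (pair_word v) js) \<longrightarrow> is = js)"

definition UD :: "'a set \<Rightarrow> nat \<times> nat \<Rightarrow> ('a list \<times> 'a list) set" where
  "UD X ab = {(v1, v2). v1 \<in> lists X \<and> v2 \<in> lists X \<and>
     length v1 = fst ab \<and> length v2 = snd ab \<and> uniquely_decodable (v1, v2)}"

end

theory Submission
  imports Defs
begin

text \<open>
  A pair \<open>(u, v)\<close> of nonempty words is uniquely decodable iff \<open>uv \<noteq> vu\<close>. If two different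
  factorizations over \<open>{u, v}\<close> agree, cancelling their common prefix leaves \<open>u x = v y\<close> with
  \<open>x, y \<in> {u, v}*\<close>. If, say, \<open>v = u w\<close>, then cancelling \<open>u\<close> leaves a relation of the same shape
  for the shorter pair \<open>(u, w)\<close>, and descent shows that \<open>u\<close> and \<open>v\<close> commute. Commuting words
  are powers of a common word, which can be taken to have length \<open>d = gcd a b\<close>; so the commuting
  pairs of lengths \<open>a, b\<close> correspond to the words of length \<open>d\<close>.
\<close>

text \<open>Each factor \<open>u @ w\<close> splits into the two factors \<open>u\<close> and
  \<open>w\<close>. The descent uses this to re-express both sides of a relation over the shorter
  pair.\<close>

lemma concat_lists_append_subset:
  assumes "xs \<in> lists {u, u @ w}"
  shows "concat xs \<in> concat ` lists {u, w}"
  using assms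
proof (induction xs)
  case Nil
  have "concat [] \<in> concat ` lists {u, w}" by (intro imageI) simp
  then show ?case by simp
next
  case (Cons z zs)
  then obtain ys where ys: "ys \<in> lists {u, w}" "concat zs = concat ys" by auto
  from Cons.hyps have "z = u \<or> z = u @ w" by auto
  then have "concat (z # zs) = concat (u # ys) \<or> concat (z # zs) = concat (u # w # ys)"
    using ys(2) by auto
  moreover have "u # ys \<in> lists {u, w}" "u # w # ys \<in> lists {u, w}" using ys(1) by auto
  ultimately show ?case by (metis imageI)
qed

lemma append_commute_if_prefix_relation:
  fixes u v :: "'a list"
  assumes "xs \<in> lists {u, v}" "ys \<in> lists {u, v}" "u @ concat xs = v @ concat ys"
  shows "u @ v = v @ u"
  using assms
proof (induction "length u + length v" arbitrary: u v xs ys rule: less_induct)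
  case less
  \<comment> \<open>The relation is symmetric in the two words, so it suffices to treat the order in
    which the first is not longer than the second.\<close>
  have step: "p @ q = q @ p"
    if le: "length p \<le> length q" and len: "length p + length q = length u + length v"
      and xs: "xs \<in> lists {p, q}" and ys: "ys \<in> lists {p, q}"
      and eq: "p @ concat xs = q @ concat ys" for p q :: "'a list" and xs ys
  proof -
    obtain w where q: "q = p @ w"
      using eq le by (metis append_eq_append_conv_if append_take_drop_id)
    show ?thesis
    proof (cases "p = [] \<or> w = []")
      case True
      then show ?thesis using q by auto
    next
      case False
      have xw: "concat xs = w @ concat ys" using eq q by simp
      \<comment> \<open>As \<open>w\<close> is nonempty, so is \<open>xs\<close>, and its first
        factor, \<open>p\<close> or \<open>p @ w\<close>, starts with \<open>p\<close>. Hence the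
        cancelled relation again has \<open>p\<close> leading on one side and \<open>w\<close> on
        the other.\<close>
      then obtain z zs where z: "xs = z # zs" using False by (cases xs) auto
      have zs: "zs \<in> lists {p, p @ w}" and "z = p \<or> z = p @ w" using xs z q by auto
      then have "z # zs = p # zs \<or> concat (z # zs) = p @ w @ concat zs" by auto
      moreover obtain zs' where zs': "zs' \<in> lists {p, w}" "concat zs = concat zs'"
        using concat_lists_append_subset[OF zs] by auto
      ultimately have "concat xs = p @ concat zs' \<or> concat xs = p @ concat (w # zs')"
        using z by auto
      moreover have "w # zs' \<in> lists {p, w}" using zs'(1) by auto
      ultimately obtain xs' where xs': "xs' \<in> lists {p, w}" "concat xs = p @ concat xs'"
        using zs'(1) by blast
      obtain ys' where ys': "ys' \<in> lists {p, w}" "concat ys = concat ys'"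
        using concat_lists_append_subset[of ys p w] ys q by auto
      have "length p > 0" using False by simp
      then have shorter: "length p + length w < length u + length v"
        using len unfolding q length_append by linarith
      have "p @ concat xs' = w @ concat ys'" using xw xs'(2) ys'(2) by simp
      with shorter xs'(1) ys'(1) have "p @ w = w @ p" by (rule less.hyps)
      then show ?thesis using q by simp
    qed
  qed
  show ?case
  proof (cases "length u \<le> length v")
    case True
    then show ?thesis using step[OF _ _ less.prems] by simp
  next
    case False
    have "v @ u = u @ v"
      by (rule step[of v u ys xs]) (use False less.prems in \<open>auto simp: insert_commute\<close>)
    then show ?thesis by simp
  qed
qed

text \<open>Equal leading indices cancel; different ones give a prefix relation, which would force
  \<open>u\<close> and \<open>v\<close> to commute. Nonempty factors keep one index list from being
  a proper prefix of the other.\<close>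

lemma concat_pair_word_eqD:
  assumes "u \<noteq> []" "v \<noteq> []" "u @ v \<noteq> v @ u"
    and "set is \<subseteq> {1, 2}" "set js \<subseteq> {1, 2}"
    and "concat (map (pair_word (u, v)) is) = concat (map (pair_word (u, v)) js)"
  shows "is = js"
  using assms(4-)
proof (induction "is" arbitrary: js)
  case Nil
  then show ?case using assms(1,2) by (cases js) (auto simp: pair_word_def split: if_splits)
next
  case (Cons i "is")
  have ne: "pair_word (u, v) i \<noteq> []" using assms(1,2) by (simp add: pair_word_def)
  then obtain j js' where js: "js = j # js'" using Cons.prems(3) by (cases js) auto
  have pw: "pair_word (u, v) (Suc 0) = u" "pair_word (u, v) 2 = v"
    by (simp_all add: pair_word_def)
  have in_uv: "map (pair_word (u, v)) ks \<in> lists {u, v}" for ks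
    by (auto simp: pair_word_def)
  have "i = j"
  proof (rule ccontr)
    assume "i \<noteq> j"
    then have "(i = 1 \<and> j = 2) \<or> (i = 2 \<and> j = 1)" using Cons.prems(1,2) js by auto
    then have "u @ concat (map (pair_word (u, v)) is) = v @ concat (map (pair_word (u, v)) js') \<or>
        u @ concat (map (pair_word (u, v)) js') = v @ concat (map (pair_word (u, v)) is)"
      using Cons.prems(3) js by (elim disjE) (simp_all add: pw)
    then show False
      using assms(3) append_commute_if_prefix_relation[OF in_uv in_uv] by blast
  qed
  then show ?case using Cons js by auto
qed

lemma uniquely_decodable_iff_not_commute:
  assumes "u \<noteq> []" "v \<noteq> []"
  shows "uniquely_decodable (u, v) \<longleftrightarrow> u @ v \<noteq> v @ u"
proof
  assume ud: "uniquely_decodable (u, v)"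
  show "u @ v \<noteq> v @ u"
  proof
    assume "u @ v = v @ u"
    then have "concat (map (pair_word (u, v)) [1, 2]) = concat (map (pair_word (u, v)) [2, 1])"
      by (simp add: pair_word_def)
    then have "[1, 2] = [2, 1 :: nat]"
      using ud[unfolded uniquely_decodable_def, rule_format, of "[1, 2]" "[2, 1]"] by simp
    then show False by simp
  qed
next
  assume "u @ v \<noteq> v @ u"
  then show "uniquely_decodable (u, v)"
    unfolding uniquely_decodable_def using concat_pair_word_eqD[OF assms] by blast
qed

lemma concat_replicate_mult:
  "concat (replicate (m * k) z) = concat (replicate m (concat (replicate k z)))"
  by (induction m) (auto simp: replicate_add)

lemma length_concat_replicate: "length (concat (replicate k z)) = k * length z"
  by (induction k) auto

lemma concat_replicate_commute:
  "concat (replicate m z) @ concat (replicate k z) = concat (replicate k z) @ concat (replicate m z)"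
  by (metis add.commute concat_append replicate_add)

text \<open>Parametrizing by words of length \<open>d\<close>, primitive or not, gives each
  commuting pair exactly one parameter and makes counting immediate.\<close>

lemma bij_betw_commuting_pairs:
  fixes a b :: nat
  assumes "a \<ge> 1" "b \<ge> 1"
  defines "d \<equiv> gcd a b"
  shows "bij_betw (\<lambda>w. (concat (replicate (a div d) w), concat (replicate (b div d) w)))
    {w. set w \<subseteq> X \<and> length w = d}
    {(u, v). set u \<subseteq> X \<and> set v \<subseteq> X \<and> length u = a \<and> length v = b \<and> u @ v = v @ u}"
    (is "bij_betw ?f ?W ?C")
  unfolding bij_betw_def
proof
  have da: "d dvd a" "d dvd b" and d0: "d > 0" using assms by (auto simp: d_def)
  have a0: "a div d > 0" using da d0 assms(1) by (auto elim!: dvdE)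
  show "inj_on ?f ?W"
  proof (rule inj_onI)
    fix w w' assume w: "w \<in> ?W" "w' \<in> ?W" and "?f w = ?f w'"
    \<comment> \<open>The exponent is positive, so \<open>w\<close> and \<open>w'\<close> are
      prefixes of equal length of the same word.\<close>
    moreover obtain k where "a div d = Suc k" using a0 gr0_implies_Suc by blast
    ultimately show "w = w'" by simp
  qed
  show "?f ` ?W = ?C"
  proof
    show "?f ` ?W \<subseteq> ?C"
      using da by (auto simp: length_concat_replicate concat_replicate_commute)
    show "?C \<subseteq> ?f ` ?W"
    proof
      fix p assume "p \<in> ?C"
      then obtain u v where p: "p = (u, v)" and X: "set u \<subseteq> X" "set v \<subseteq> X"
        and a: "a = length u" and b: "b = length v" and "u @ v = v @ u"
        by auto
      then obtain m k z where u: "concat (replicate m z) = u" and v: "concat (replicate k z) = v"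
        using comm_append_are_replicate by metis
      have la: "a = m * length z" and lb: "b = k * length z"
        using a b u v length_concat_replicate by metis+
      \<comment> \<open>The common root \<open>z\<close> may be shorter than \<open>d\<close>, but
        its length divides both \<open>a\<close> and \<open>b\<close>; a suitable power of
        \<open>z\<close> then has length exactly \<open>d\<close>.\<close>
      then have "length z dvd d" by (simp add: d_def)
      then obtain e where e: "d = e * length z" by (metis dvd_def mult.commute)
      have z0: "length z > 0" using la assms(1) by (cases z) auto
      have m: "m = (a div d) * e" and k: "k = (b div d) * e"
        using z0 d0 da by (auto simp: la lb e)
      define w where "w = concat (replicate e z)"
      have "?f w = (u, v)" using u v m k by (simp add: w_def concat_replicate_mult)
      moreover have "set w \<subseteq> X"
      proof -
        \<comment> \<open>A positive exponent makes \<open>z\<close> occur in \<open>u\<close>, so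
          its letters lie in \<open>X\<close>.\<close>
        have "m \<noteq> 0" using la assms(1) by auto
        then have "set z \<subseteq> X" using X(1) u by auto
        then show ?thesis by (auto simp: w_def)
      qed
      moreover have "length w = d" unfolding w_def length_concat_replicate e ..
      ultimately show "p \<in> ?f ` ?W" unfolding p by (intro rev_image_eqI[of w]) auto
    qed
  qed
qed

theorem theorem5:
  fixes X :: "'a set" and n a b :: nat
  assumes "finite X" and "card X = n" and "n \<ge> 2" and "a \<ge> 1" and "b \<ge> 1"
  shows "int (card (UD X (a, b))) = int n ^ (a + b) - int n ^ gcd a b"
proof -
  define W where "W l = {w. set w \<subseteq> X \<and> length w = l}" for l
  define C where
    "C = {(u, v). set u \<subseteq> X \<and> set v \<subseteq> X \<and> length u = a \<and> length v = b \<and> u @ v = v @ u}"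
  have cardW: "card (W l) = n ^ l" and finW: "finite (W l)" for l
    using card_lists_length_eq[OF assms(1)] finite_lists_length_eq[OF assms(1)] assms(2)
    by (auto simp: W_def)
  have "UD X (a, b) = W a \<times> W b - C"
  proof -
    have "uniquely_decodable (u, v) \<longleftrightarrow> u @ v \<noteq> v @ u" if "length u = a" "length v = b"
      for u v :: "'a list"
      by (rule uniquely_decodable_iff_not_commute) (use that assms(4,5) in auto)
    then show ?thesis by (auto simp: UD_def W_def C_def)
  qed
  moreover have sub: "C \<subseteq> W a \<times> W b" by (auto simp: C_def W_def)
  moreover have "card C = n ^ gcd a b"
    using bij_betw_same_card[OF bij_betw_commuting_pairs[OF assms(4,5), of X]] cardW
    by (simp add: C_def W_def)
  moreover have "card (W a \<times> W b) = n ^ (a + b)"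
    by (simp add: card_cartesian_product cardW power_add)
  moreover have "finite (W a \<times> W b)" using finW by simp
  \<comment> \<open>The inequality makes the subtraction of naturals agree with that of
    integers.\<close>
  moreover from this sub have "finite C" "card C \<le> card (W a \<times> W b)"
    by (auto intro: finite_subset card_mono)
  ultimately show ?thesis by (simp add: card_Diff_subset of_nat_diff)
qed

end
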